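(* Let $N=\{1,\dots,n\}$. Let $X_1,\dots,X_n$ be a random sample (i.i.d. real random variables) drawn from a continuous cumulative distribution function $F:\mathbb{R}\to\mathbb{R}$ with associated probability density function $f:\mathbb{R}\to\mathbb{R}$, and let $X_{1:n}\leqslant\cdots\leqslant X_{n:n}$ be the corresponding order statistics. Let $h:\mathbb{R}\to\mathbb{R}$ be any measurable function. For any game $\nu$ on $N$, put $$Y_\nu:=C_\nu(X_1,\dots,X_n),\qquad Y_\nu^\sigma:=\sum_{i=1}^n p_i^{\nu,\sigma}\,X_{n-i+1:n}\quad(\sigma\in\mathfrak{S}_n).$$ Then $$\mathbf{E}[h(Y_\nu)]=\frac{1}{n!}\sum_{\sigma\in\mathfrak{S}_n}\mathbf{E}[h(Y_\nu^\sigma)].$$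
   Context: $\mathfrak{S}_n$ denotes the set of permutations of $N=\{1,\dots,n\}$. A game on $N$ is a set function $\nu:2^N\to[0,1]$ with $\nu(\varnothing)=0$ (no monotonicity is required). For $\sigma\in\mathfrak{S}_n$ and $i=0,\dots,n$, let $\nu_i^\sigma:=\nu(\{\sigma(1),\dots,\sigma(i)\})$ (so $\nu_0^\sigma=0$), and for $i\in N$ let $p_i^{\nu,\sigma}:=\nu_i^\sigma-\nu_{i-1}^\sigma$. The discrete Choquet integral of $\mathbf{x}\in\mathbb{R}^n$ with respect to $\nu$ is $C_\nu(\mathbf{x}):=\sum_{i=1}^n p_i^{\nu,\sigma}\,x_{\sigma(i)}$, where $\sigma\in\mathfrak{S}_n$ is such that $x_{\sigma(1)}\geqslant\cdots\geqslant x_{\sigma(n)}$ (the value does not depend on the choice of such $\sigma$). The order statistics $X_{1:n}\leqslant\cdots\leqslant X_{n:n}$ are the values $X_1,\dots,X_n$ rearranged in nondecreasing order. $\mathbf{E}$ denotes expectation. *)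

theory Defs
  imports "HOL-Probability.Probability" "HOL-Combinatorics.Permutations"
begin

text \<open>Games on \<open>{1..n}\<close>; only the values on subsets of \<open>{1..n}\<close> matter. No monotonicity
  and no normalisation of the grand coalition is required.\<close>

definition game :: "nat \<Rightarrow> (nat set \<Rightarrow> real) \<Rightarrow> bool" where
  "game n \<nu> \<longleftrightarrow> \<nu> {} = 0 \<and> (\<forall>A\<subseteq>{1..n}. 0 \<le> \<nu> A \<and> \<nu> A \<le> 1)"

definition chain_value :: "(nat set \<Rightarrow> real) \<Rightarrow> (nat \<Rightarrow> nat) \<Rightarrow> nat \<Rightarrow> real" where
  "chain_value \<nu> \<sigma> i = \<nu> (\<sigma> ` {1..i})"

definition increment :: "(nat set \<Rightarrow> real) \<Rightarrow> (nat \<Rightarrow> nat) \<Rightarrow> nat \<Rightarrow> real" where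
  "increment \<nu> \<sigma> i = chain_value \<nu> \<sigma> i - chain_value \<nu> \<sigma> (i - 1)"

text \<open>A vector in \<open>n\<close>-space is a function \<open>nat \<Rightarrow> real\<close> read on \<open>{1..n}\<close>. A permutation as
  below always exists, and the value does not depend on which one is selected in case of ties.\<close>

definition choquet :: "nat \<Rightarrow> (nat set \<Rightarrow> real) \<Rightarrow> (nat \<Rightarrow> real) \<Rightarrow> real" where
  "choquet n \<nu> x =
     (let \<sigma> = (SOME \<sigma>. \<sigma> permutes {1..n} \<and> antimono_on {1..n} (\<lambda>i. x (\<sigma> i)))
      in \<Sum>i=1..n. increment \<nu> \<sigma> i * x (\<sigma> i))"

text \<open>The \<open>k\<close>-th smallest of \<open>x 1, \<dots>, x n\<close>, counted with multiplicity, for \<open>1 \<le> k \<le> n\<close>.\<close>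

definition order_stat :: "nat \<Rightarrow> (nat \<Rightarrow> real) \<Rightarrow> nat \<Rightarrow> real" where
  "order_stat n x k = sort (map x [1..<Suc n]) ! (k - 1)"

definition order_stat_comb ::
    "nat \<Rightarrow> (nat set \<Rightarrow> real) \<Rightarrow> (nat \<Rightarrow> nat) \<Rightarrow> (nat \<Rightarrow> real) \<Rightarrow> real" where
  "order_stat_comb n \<nu> \<sigma> x = (\<Sum>i=1..n. increment \<nu> \<sigma> i * order_stat n x (n - i + 1))"

text \<open>Expectations with values in the extended reals. As \<open>ennreal\<close> sends negative reals to
  \<open>0\<close>, the two integrals are those of the positive and of the negative part of \<open>Z\<close>; the
  expectation exists unless both are infinite.\<close>

definition pos_integral :: "'a measure \<Rightarrow> ('a \<Rightarrow> real) \<Rightarrow> ennreal" where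
  "pos_integral M Z = (\<integral>\<^sup>+\<omega>. ennreal (Z \<omega>) \<partial>M)"

definition neg_integral :: "'a measure \<Rightarrow> ('a \<Rightarrow> real) \<Rightarrow> ennreal" where
  "neg_integral M Z = (\<integral>\<^sup>+\<omega>. ennreal (- Z \<omega>) \<partial>M)"

definition has_ext_expectation :: "'a measure \<Rightarrow> ('a \<Rightarrow> real) \<Rightarrow> bool" where
  "has_ext_expectation M Z \<longleftrightarrow> Z \<in> borel_measurable M \<and>
     (pos_integral M Z < \<infinity> \<or> neg_integral M Z < \<infinity>)"

definition ext_expectation :: "'a measure \<Rightarrow> ('a \<Rightarrow> real) \<Rightarrow> ereal" where
  "ext_expectation M Z = enn2ereal (pos_integral M Z) - enn2ereal (neg_integral M Z)"

text \<open>A finite sum of extended expectations is meaningful if every term exists and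
  \<open>\<infinity>\<close> and \<open>-\<infinity>\<close> do not both occur among the terms.\<close>

definition has_ext_expectation_sum :: "'a measure \<Rightarrow> ('b \<Rightarrow> 'a \<Rightarrow> real) \<Rightarrow> 'b set \<Rightarrow> bool" where
  "has_ext_expectation_sum M Z A \<longleftrightarrow> (\<forall>a\<in>A. has_ext_expectation M (Z a)) \<and>
     \<not> ((\<exists>a\<in>A. ext_expectation M (Z a) = \<infinity>) \<and> (\<exists>a\<in>A. ext_expectation M (Z a) = - \<infinity>))"

lemma ext_expectation_integrable:
  assumes "integrable M Z"
  shows "has_ext_expectation M Z" "ext_expectation M Z = ereal (\<integral>\<omega>. Z \<omega> \<partial>M)"
proof -
  have m: "Z \<in> borel_measurable M"
    and p: "pos_integral M Z \<noteq> \<infinity>" and q: "neg_integral M Z \<noteq> \<infinity>"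
    using assms by (auto simp: real_integrable_def pos_integral_def neg_integral_def)
  show "has_ext_expectation M Z"
    using m p by (simp add: has_ext_expectation_def less_top)
  have "(\<integral>\<omega>. Z \<omega> \<partial>M) = enn2real (pos_integral M Z) - enn2real (neg_integral M Z)"
    using real_lebesgue_integral_def[OF assms] by (simp add: pos_integral_def neg_integral_def)
  moreover have "enn2ereal a = ereal (enn2real a)" if "a \<noteq> \<infinity>" for a
    using that by (cases a) (auto simp: enn2ereal_ennreal)
  ultimately show "ext_expectation M Z = ereal (\<integral>\<omega>. Z \<omega> \<partial>M)"
    using p q by (simp add: ext_expectation_def)
qed

end

theory Submission
  imports Defs
begin

text \<open>Relabelling the sample leaves its joint law unchanged, and almost surely there are no ties, so
  exactly one permutation \<open>\<tau>\<close> sorts the sample. On the event that \<open>\<tau>\<close> sorts it, \<open>Y\<close> coincides with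
  \<open>Y' \<tau>\<close>; as \<open>Y' \<tau>\<close> is symmetric in the sample, this event contributes \<open>1 / n!\<close> of the integral of
  \<open>g (Y' \<tau>)\<close> for every nonnegative \<open>g\<close>. Taking for \<open>g\<close> the positive and the negative part of
  \<open>h\<close> gives all the claims.\<close>

section \<open>Sorting permutations and order statistics\<close>

definition sorts :: "nat \<Rightarrow> (nat \<Rightarrow> real) \<Rightarrow> (nat \<Rightarrow> nat) \<Rightarrow> bool" where
  "sorts n x \<sigma> \<longleftrightarrow> \<sigma> permutes {1..n} \<and> antimono_on {1..n} (\<lambda>i. x (\<sigma> i))"

text \<open>Literally the choice made inside \<open>choquet\<close>, so facts about it also apply in
  the presence of ties.\<close>

definition sorter :: "nat \<Rightarrow> (nat \<Rightarrow> real) \<Rightarrow> nat \<Rightarrow> nat" where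
  "sorter n x = (SOME \<sigma>. sorts n x \<sigma>)"

text \<open>Sorting the list of indices by the key \<open>- x i\<close> puts the largest values
  first; the permutation reads off this list.\<close>

lemma sorts_exists: "\<exists>\<sigma>. sorts n x \<sigma>"
proof -
  define l where "l = sort_key (\<lambda>i. - x i) [1..<Suc n]"
  have len: "length l = n" and dist: "distinct l" and set: "set l = {1..n}"
    and srt: "sorted (map (\<lambda>i. - x i) l)"
    by (auto simp: l_def)
  \<comment> \<open>List positions start at 0, hence \<open>i - 1\<close>; off \<open>{1..n}\<close>
    the identity is required by \<open>permutes\<close>.\<close>
  define \<sigma> where "\<sigma> i = (if i \<in> {1..n} then l ! (i - 1) else i)" for i
  have "bij_betw (\<lambda>i. i - 1) {1..n} {..<n}"
    by (rule bij_betw_byWitness[where f' = Suc]) auto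
  from bij_betw_trans[OF this bij_betw_nth[OF dist, of "{..<n}" "{1..n}"]]
  have "bij_betw \<sigma> {1..n} {1..n}"
    by (rule iffD1[OF bij_betw_cong, rotated]) (auto simp: \<sigma>_def len set)
  then have perm: "\<sigma> permutes {1..n}"
    by (rule bij_imp_permutes) (auto simp: \<sigma>_def)
  have "antimono_on {1..n} (\<lambda>i. x (\<sigma> i))"
  proof (rule monotone_onI)
    fix i j assume "i \<in> {1..n}" "j \<in> {1..n}" "i \<le> j"
    then show "x (\<sigma> i) \<ge> x (\<sigma> j)"
      using sorted_nth_mono[OF srt, of "i - 1" "j - 1"] by (simp add: \<sigma>_def len)
  qed
  with perm show ?thesis
    by (auto simp: sorts_def)
qed

lemma sorts_sorter: "sorts n x (sorter n x)"
  unfolding sorter_def using sorts_exists by (rule someI_ex)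

text \<open>Vectors are total functions, while points of the product space are
  \<open>undefined\<close> off \<open>{1..n}\<close>. This and the later congruence lemmas bridge
  the two.\<close>

lemma sorts_cong:
  assumes "\<And>i. i \<in> {1..n} \<Longrightarrow> x i = y i"
  shows "sorts n x \<sigma> \<longleftrightarrow> sorts n y \<sigma>"
proof (cases "\<sigma> permutes {1..n}")
  case True
  then have "x (\<sigma> i) = y (\<sigma> i)" if "i \<in> {1..n}" for i
    using assms permutes_in_image[OF True] that by blast
  then show ?thesis
    by (auto simp: sorts_def monotone_on_def)
qed (simp add: sorts_def)

lemma sorts_comp:
  assumes "\<sigma> permutes {1..n}" and "\<tau> permutes {1..n}"
  shows "sorts n (\<lambda>i. x (\<sigma> i)) \<tau> \<longleftrightarrow> sorts n x (\<sigma> \<circ> \<tau>)"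
  using assms by (simp add: sorts_def permutes_compose)

lemma mset_map_permutes:
  assumes "\<sigma> permutes {1..n}"
  shows "mset (map (\<lambda>i. x (\<sigma> i)) [1..<Suc n]) = mset (map x [1..<Suc n])"
proof -
  have "mset (map (\<lambda>i. x (\<sigma> i)) [1..<Suc n]) = image_mset x (image_mset \<sigma> (mset_set {1..n}))"
    by (simp add: atLeastLessThanSuc_atLeastAtMost image_mset.compositionality comp_def del: upt_Suc)
  also have "image_mset \<sigma> (mset_set {1..n}) = mset_set {1..n}"
    using assms by (simp add: image_mset_mset_set permutes_inj_on permutes_image)
  finally show ?thesis
    by (simp add: atLeastLessThanSuc_atLeastAtMost del: upt_Suc)
qed

text \<open>Sorting sees only the multiset of entries, which relabelling preserves.\<close>

lemma order_stat_permutes: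
  "\<sigma> permutes {1..n} \<Longrightarrow> order_stat n (\<lambda>i. x (\<sigma> i)) = order_stat n x"
  unfolding order_stat_def fun_eq_iff
  by (metis mset_map_permutes sorted_list_of_multiset_mset)

lemma order_stat_sorts:
  assumes "sorts n x \<sigma>" and "i \<in> {1..n}"
  shows "order_stat n x (n - i + 1) = x (\<sigma> i)"
proof -
  define y where "y i = x (\<sigma> i)" for i
  have perm: "\<sigma> permutes {1..n}" and anti: "antimono_on {1..n} y"
    using assms by (auto simp: sorts_def y_def[abs_def])
  \<comment> \<open>A nonincreasing list is sorted by reversing it. Position \<open>n - i\<close> of
    the reversed list, counted from 0, is position \<open>i - 1\<close> of the original one, which
    holds \<open>y i\<close>.\<close>
  have "sort (map y [1..<Suc n]) = rev (map y [1..<Suc n])"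
  proof (rule properties_for_sort)
    show "sorted (rev (map y [1..<Suc n]))"
      using anti by (auto simp: sorted_rev_iff_nth_mono monotone_on_def simp del: upt_Suc)
  qed simp
  moreover have "order_stat n x = order_stat n y"
    unfolding y_def by (rule order_stat_permutes[OF perm, symmetric])
  ultimately show ?thesis
    using assms(2) by (auto simp: order_stat_def rev_nth y_def simp del: upt_Suc)
qed

text \<open>By \<open>order_stat_sorts\<close> both permutations point to the same value at each
  position, and without ties a value determines its index.\<close>

lemma sorts_unique:
  assumes "inj_on x {1..n}" and "sorts n x \<sigma>" and "sorts n x \<tau>"
  shows "\<sigma> = \<tau>"
proof
  fix i
  have perm: "\<sigma> permutes {1..n}" "\<tau> permutes {1..n}"
    using assms by (auto simp: sorts_def)
  show "\<sigma> i = \<tau> i"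
  proof (cases "i \<in> {1..n}")
    case True
    then have "x (\<sigma> i) = x (\<tau> i)"
      using order_stat_sorts assms by metis
    moreover have "\<sigma> i \<in> {1..n}" "\<tau> i \<in> {1..n}"
      using True perm permutes_in_image by metis+
    ultimately show ?thesis
      using assms(1) by (meson inj_onD)
  next
    case False
    then show ?thesis
      using perm by (metis permutes_not_in)
  qed
qed

lemma choquet_eq_sorter: "choquet n \<nu> x = (\<Sum>i=1..n. increment \<nu> (sorter n x) i * x (sorter n x i))"
  by (simp add: choquet_def sorter_def sorts_def Let_def)

lemma order_stat_comb_sorts:
  assumes "sorts n x \<tau>"
  shows "order_stat_comb n \<nu> \<sigma> x = (\<Sum>i=1..n. increment \<nu> \<sigma> i * x (\<tau> i))"
  unfolding order_stat_comb_def
  by (rule sum.cong) (simp_all only: order_stat_sorts[OF assms])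

text \<open>The pointwise link between the two sides of the theorem: along the chosen sorting
  permutation, the sorted entries are the order statistics.\<close>

lemma choquet_eq_order_stat_comb: "choquet n \<nu> x = order_stat_comb n \<nu> (sorter n x) x"
  by (simp add: choquet_eq_sorter order_stat_comb_sorts[OF sorts_sorter])

lemma order_stat_comb_permutes:
  "\<tau> permutes {1..n} \<Longrightarrow> order_stat_comb n \<nu> \<sigma> (\<lambda>i. x (\<tau> i)) = order_stat_comb n \<nu> \<sigma> x"
  by (simp add: order_stat_comb_def order_stat_permutes)

lemma order_stat_comb_cong:
  assumes "\<And>i. i \<in> {1..n} \<Longrightarrow> x i = y i"
  shows "order_stat_comb n \<nu> \<sigma> x = order_stat_comb n \<nu> \<sigma> y"
proof -
  have "map x [1..<Suc n] = map y [1..<Suc n]"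
    using assms by (simp del: upt_Suc)
  then show ?thesis
    by (simp only: order_stat_comb_def order_stat_def)
qed

lemma choquet_cong:
  assumes "\<And>i. i \<in> {1..n} \<Longrightarrow> x i = y i"
  shows "choquet n \<nu> x = choquet n \<nu> y"
proof -
  \<comment> \<open>The choice depends on the vector only through the predicate
    \<open>sorts n x\<close>, so equal predicates give the same chosen permutation.\<close>
  have "sorts n x = sorts n y"
    by (intro ext sorts_cong assms)
  then have "sorter n x = sorter n y"
    by (simp add: sorter_def)
  with order_stat_comb_cong[OF assms] show ?thesis
    by (simp add: choquet_eq_order_stat_comb)
qed

section \<open>Measurability on the product space\<close>

abbreviation sample_space :: "nat \<Rightarrow> (nat \<Rightarrow> real) measure" where
  "sample_space n \<equiv> PiM {1..n} (\<lambda>_. borel)"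

lemma pred_sorts [measurable]: "Measurable.pred (sample_space n) (\<lambda>x. sorts n x \<sigma>)"
proof (cases "\<sigma> permutes {1..n}")
  case True
  \<comment> \<open>Monotonicity becomes finitely many inequalities between coordinates, one for
    each pair in \<open>?J\<close>.\<close>
  let ?J = "{(i, j) \<in> {1..n} \<times> {1..n}. i \<le> j}"
  have coord: "(\<lambda>x. x (\<sigma> i)) \<in> borel_measurable (sample_space n)" if "i \<in> {1..n}" for i
    using permutes_in_image[OF True] that by (intro measurable_component_singleton) blast
  have "finite ?J"
    by (rule finite_subset[of _ "{1..n} \<times> {1..n}"]) auto
  then have "{x \<in> space (sample_space n). \<forall>p\<in>?J. x (\<sigma> (snd p)) \<le> x (\<sigma> (fst p))} \<in> sets (sample_space n)"
    by (rule sets.sets_Collect_finite_All[rotated]) (rule borel_measurable_le, (rule coord, force)+)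
  moreover have "sorts n x \<sigma> \<longleftrightarrow> (\<forall>p\<in>?J. x (\<sigma> (snd p)) \<le> x (\<sigma> (fst p)))" for x
    using True by (auto simp: sorts_def monotone_on_def)
  ultimately show ?thesis
    by (simp only: Measurable.pred_def)
qed (simp add: sorts_def)

text \<open>The set of all sorting permutations takes finitely many values, each on a measurable set, and
  \<open>sorter\<close> is a function of that set; so the arbitrary choice in case of ties does no harm.\<close>

lemma measurable_sorter [measurable]:
  "sorter n \<in> sample_space n \<rightarrow>\<^sub>M count_space {\<sigma>. \<sigma> permutes {1..n}}"
proof -
  let ?P = "{\<sigma>. \<sigma> permutes {1..n}}"
  have "(\<lambda>x. Collect (sorts n x)) \<in> sample_space n \<rightarrow>\<^sub>M count_space (Pow ?P)"
  proof (subst measurable_count_space_eq2)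
    have "(\<lambda>x. Collect (sorts n x)) -` {A} \<inter> space (sample_space n) \<in> sets (sample_space n)"
      if "A \<subseteq> ?P" for A
    proof -
      have "Collect (sorts n x) = A \<longleftrightarrow> (\<forall>\<sigma>\<in>?P. sorts n x \<sigma> \<longleftrightarrow> \<sigma> \<in> A)" for x
        using that unfolding sorts_def by blast
      then have "(\<lambda>x. Collect (sorts n x)) -` {A} \<inter> space (sample_space n)
          = {x \<in> space (sample_space n). \<forall>\<sigma>\<in>?P. sorts n x \<sigma> \<longleftrightarrow> \<sigma> \<in> A}"
        by blast
      also have "\<dots> \<in> sets (sample_space n)"
      proof (intro sets.sets_Collect_finite_All finite_permutations finite_atLeastAtMost)
        show "{x \<in> space (sample_space n). sorts n x \<sigma> \<longleftrightarrow> \<sigma> \<in> A} \<in> sets (sample_space n)" for \<sigma>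
          by (cases "\<sigma> \<in> A"; simp only: simp_thms; measurable)
      qed
      finally show ?thesis .
    qed
    then show "(\<lambda>x. Collect (sorts n x)) \<in> space (sample_space n) \<rightarrow> Pow ?P \<and>
        (\<forall>A\<in>Pow ?P. (\<lambda>x. Collect (sorts n x)) -` {A} \<inter> space (sample_space n) \<in> sets (sample_space n))"
      by (auto simp: sorts_def)
  qed (simp add: finite_permutations)
  \<comment> \<open>On nonempty sets this is the choice made by \<open>sorter\<close>; the value
    \<open>id\<close> at \<open>{}\<close> only keeps \<open>c\<close> inside
    \<open>?P\<close>.\<close>
  moreover define c where "c A = (if A = {} then id else SOME \<sigma>. \<sigma> \<in> A)" for A :: "(nat \<Rightarrow> nat) set"
  have "c A \<in> ?P" if "A \<in> Pow ?P" for A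
    using that some_in_eq[of A] permutes_id[of "{1..n}"] by (cases "A = {}") (auto simp: c_def)
  then have "c \<in> count_space (Pow ?P) \<rightarrow>\<^sub>M count_space ?P"
    unfolding measurable_count_space_eq1 by (simp add: Pi_iff)
  ultimately have "(\<lambda>x. c (Collect (sorts n x))) \<in> sample_space n \<rightarrow>\<^sub>M count_space ?P"
    by (rule measurable_compose)
  also have "(\<lambda>x. c (Collect (sorts n x))) = sorter n"
    using sorts_exists by (auto simp: c_def sorter_def fun_eq_iff)
  finally show ?thesis .
qed

text \<open>Wherever \<open>sorter\<close> is constant the expression is linear in the coordinates,
  and \<open>sorter\<close> has finitely many values. Letting \<open>c\<close> depend on the
  permutation covers \<open>choquet\<close>; a constant \<open>c\<close> covers
  \<open>order_stat_comb\<close>.\<close>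

lemma measurable_sorter_sum:
  "(\<lambda>x. \<Sum>i=1..n. c (sorter n x) i * x (sorter n x i)) \<in> borel_measurable (sample_space n)"
proof (rule measurable_compose_countable'[OF _ measurable_sorter countable_finite[OF finite_permutations[OF finite_atLeastAtMost]]])
  fix \<sigma> assume "\<sigma> \<in> {\<sigma>. \<sigma> permutes {1..n}}"
  then have "(\<lambda>x. x (\<sigma> i)) \<in> borel_measurable (sample_space n)" if "i \<in> {1..n}" for i
    using permutes_in_image[of \<sigma> "{1..n}"] that by (intro measurable_component_singleton) blast
  then show "(\<lambda>x. \<Sum>i=1..n. c \<sigma> i * x (\<sigma> i)) \<in> borel_measurable (sample_space n)"
    by (intro borel_measurable_sum borel_measurable_times) auto
qed

lemma measurable_choquet [measurable]: "choquet n \<nu> \<in> borel_measurable (sample_space n)"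
  using measurable_sorter_sum[of "increment \<nu>" n] by (simp add: choquet_eq_sorter[abs_def])

lemma measurable_order_stat_comb [measurable]:
  "order_stat_comb n \<nu> \<sigma> \<in> borel_measurable (sample_space n)"
  using measurable_sorter_sum[of "\<lambda>_. increment \<nu> \<sigma>" n]
  by (simp add: order_stat_comb_sorts[OF sorts_sorter, abs_def])

section \<open>Exchangeable laws without ties\<close>

locale exchangeable_without_ties =
  fixes n :: nat and P :: "(nat \<Rightarrow> real) measure"
  assumes sets_P [measurable_cong]: "sets P = sets (sample_space n)"
    and exchangeable: "\<And>\<sigma>. \<sigma> permutes {1..n} \<Longrightarrow> distr P P (\<lambda>x. \<lambda>i\<in>{1..n}. x (\<sigma> i)) = P"
    and no_ties: "AE x in P. inj_on x {1..n}"
begin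

text \<open>The substitution sending \<open>x\<close> to its relabelling by \<open>\<tau>\<close>
  preserves \<open>P\<close>, pulls the event that \<open>id\<close> sorts back to the event that
  \<open>\<tau>\<close> sorts, and fixes the symmetric factor. Here \<open>\<sigma>\<close> and
  \<open>\<tau>\<close> are unrelated.\<close>

lemma nn_integral_sorts:
  assumes \<tau>: "\<tau> permutes {1..n}" and [measurable]: "g \<in> borel_measurable borel"
  shows "(\<integral>\<^sup>+x. indicator {x. sorts n x \<tau>} x * g (order_stat_comb n \<nu> \<sigma> x) \<partial>P)
    = (\<integral>\<^sup>+x. indicator {x. sorts n x id} x * g (order_stat_comb n \<nu> \<sigma> x) \<partial>P)"
proof -
  let ?f = "\<lambda>\<tau> x. indicator {x. sorts n x \<tau>} x * g (order_stat_comb n \<nu> \<sigma> x)"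
  let ?T = "\<lambda>x. \<lambda>i\<in>{1..n}. x (\<tau> i)"
  have "?T \<in> sample_space n \<rightarrow>\<^sub>M sample_space n"
    using permutes_in_image[OF \<tau>] by (intro measurable_restrict measurable_component_singleton) blast
  then have [measurable]: "?T \<in> P \<rightarrow>\<^sub>M P"
    by (simp add: measurable_cong_sets[OF sets_P sets_P])
  have shift: "?f id (?T x) = ?f \<tau> x" for x
  proof -
    have "sorts n (?T x) id \<longleftrightarrow> sorts n (\<lambda>i. x (\<tau> i)) id"
      by (rule sorts_cong) simp
    also have "\<dots> \<longleftrightarrow> sorts n x \<tau>"
      by (simp add: sorts_comp[OF \<tau> permutes_id])
    finally have "sorts n (?T x) id \<longleftrightarrow> sorts n x \<tau>" .
    moreover have "order_stat_comb n \<nu> \<sigma> (?T x) = order_stat_comb n \<nu> \<sigma> (\<lambda>i. x (\<tau> i))"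
      by (rule order_stat_comb_cong) simp
    ultimately show ?thesis
      by (simp add: order_stat_comb_permutes[OF \<tau>] indicator_def)
  qed
  have "(\<integral>\<^sup>+x. ?f id x \<partial>P) = (\<integral>\<^sup>+x. ?f id x \<partial>distr P P ?T)"
    by (simp only: exchangeable[OF \<tau>])
  also have "\<dots> = (\<integral>\<^sup>+x. ?f id (?T x) \<partial>P)"
    by (rule nn_integral_distr) measurable
  also have "\<dots> = (\<integral>\<^sup>+x. ?f \<tau> x \<partial>P)"
    by (simp only: shift)
  finally show ?thesis ..
qed

text \<open>Without ties exactly one indicator is nonzero. The dependence of \<open>u\<close> on the
  permutation allows both a fixed integrand and one that changes with the sorting
  permutation.\<close>

lemma AE_sum_sorts:
  fixes u :: "(nat \<Rightarrow> real) \<Rightarrow> (nat \<Rightarrow> nat) \<Rightarrow> ennreal"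
  shows "AE x in P. (\<Sum>\<tau> | \<tau> permutes {1..n}. indicator {x. sorts n x \<tau>} x * u x \<tau>) = u x (sorter n x)"
  using no_ties
proof eventually_elim
  fix x :: "nat \<Rightarrow> real" assume "inj_on x {1..n}"
  then have "sorts n x \<tau> \<longleftrightarrow> \<tau> = sorter n x" for \<tau>
    using sorts_unique sorts_sorter by blast
  then have "(\<Sum>\<tau> | \<tau> permutes {1..n}. indicator {x. sorts n x \<tau>} x * u x \<tau>)
      = (\<Sum>\<tau> | \<tau> permutes {1..n}. if \<tau> = sorter n x then u x \<tau> else 0)"
    by (intro sum.cong) auto
  also have "\<dots> = u x (sorter n x)"
    using sorts_sorter[of n x] by (simp add: sorts_def finite_permutations)
  finally show "(\<Sum>\<tau> | \<tau> permutes {1..n}. indicator {x. sorts n x \<tau>} x * u x \<tau>) = u x (sorter n x)" .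
qed

text \<open>Up to a null set the sorting events partition the space into \<open>n!\<close> pieces,
  which contribute equally by \<open>nn_integral_sorts\<close>.\<close>

lemma nn_integral_order_stat_comb:
  assumes [measurable]: "g \<in> borel_measurable borel"
  shows "(\<integral>\<^sup>+x. g (order_stat_comb n \<nu> \<sigma> x) \<partial>P)
    = fact n * (\<integral>\<^sup>+x. indicator {x. sorts n x id} x * g (order_stat_comb n \<nu> \<sigma> x) \<partial>P)"
proof -
  have "(\<integral>\<^sup>+x. g (order_stat_comb n \<nu> \<sigma> x) \<partial>P) = (\<integral>\<^sup>+x. (\<Sum>\<tau> | \<tau> permutes {1..n}.
      indicator {x. sorts n x \<tau>} x * g (order_stat_comb n \<nu> \<sigma> x)) \<partial>P)"
    by (rule nn_integral_cong_AE, use AE_sum_sorts[of "\<lambda>x \<tau>. g (order_stat_comb n \<nu> \<sigma> x)"] in eventually_elim) simp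
  also have "\<dots> = (\<Sum>\<tau> | \<tau> permutes {1..n}.
      \<integral>\<^sup>+x. indicator {x. sorts n x \<tau>} x * g (order_stat_comb n \<nu> \<sigma> x) \<partial>P)"
    by (rule nn_integral_sum) measurable
  also have "\<dots> = (\<Sum>\<tau> | \<tau> permutes {1..n}.
      \<integral>\<^sup>+x. indicator {x. sorts n x id} x * g (order_stat_comb n \<nu> \<sigma> x) \<partial>P)"
    by (intro sum.cong refl nn_integral_sorts) simp_all
  finally show ?thesis
    by (simp add: card_permutations[of "{Suc 0..n}" n])
qed

text \<open>On the event that \<open>\<tau>\<close> sorts, \<open>choquet\<close> is the combination
  for \<open>\<tau>\<close>; \<open>n!\<close> times this piece is the full integral of that
  combination. Multiplying by \<open>fact n\<close> avoids division in
  \<open>ennreal\<close>.\<close>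

lemma nn_integral_choquet:
  assumes [measurable]: "g \<in> borel_measurable borel"
  shows "fact n * (\<integral>\<^sup>+x. g (choquet n \<nu> x) \<partial>P)
    = (\<Sum>\<tau> | \<tau> permutes {1..n}. \<integral>\<^sup>+x. g (order_stat_comb n \<nu> \<tau> x) \<partial>P)"
proof -
  have "(\<integral>\<^sup>+x. g (choquet n \<nu> x) \<partial>P) = (\<integral>\<^sup>+x. (\<Sum>\<tau> | \<tau> permutes {1..n}.
      indicator {x. sorts n x \<tau>} x * g (order_stat_comb n \<nu> \<tau> x)) \<partial>P)"
    by (rule nn_integral_cong_AE, use AE_sum_sorts[of "\<lambda>x \<tau>. g (order_stat_comb n \<nu> \<tau> x)"] in eventually_elim)
      (simp add: choquet_eq_order_stat_comb)
  also have "\<dots> = (\<Sum>\<tau> | \<tau> permutes {1..n}.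
      \<integral>\<^sup>+x. indicator {x. sorts n x \<tau>} x * g (order_stat_comb n \<nu> \<tau> x) \<partial>P)"
    by (rule nn_integral_sum) measurable
  also have "fact n * \<dots> = (\<Sum>\<tau> | \<tau> permutes {1..n}. fact n *
      (\<integral>\<^sup>+x. indicator {x. sorts n x id} x * g (order_stat_comb n \<nu> \<tau> x) \<partial>P))"
    unfolding sum_distrib_left
    by (intro sum.cong refl arg_cong[where f = "(*) (fact n)"] nn_integral_sorts) simp_all
  finally show ?thesis
    by (simp only: nn_integral_order_stat_comb[OF assms])
qed

end

section \<open>Independent samples from an atomless law\<close>

text \<open>The joint law is a product, and every section of the diagonal is a single point, null
  for the law of \<open>Y\<close>. Fubini then makes the diagonal null.\<close>

lemma (in prob_space) AE_indep_var_neq: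
  fixes X Y :: "'a \<Rightarrow> real"
  assumes "indep_var borel X borel Y" and no_atoms: "\<And>t. emeasure (distr M borel Y) {t} = 0"
  shows "AE \<omega> in M. X \<omega> \<noteq> Y \<omega>"
proof -
  have [measurable]: "X \<in> borel_measurable M" "Y \<in> borel_measurable M"
    and pair: "distr M borel X \<Otimes>\<^sub>M distr M borel Y = distr M (borel \<Otimes>\<^sub>M borel) (\<lambda>\<omega>. (X \<omega>, Y \<omega>))"
    using assms(1) by (auto simp: indep_var_distribution_eq)
  interpret X: prob_space "distr M borel X"
    by (rule prob_space_distr) simp
  interpret Y: prob_space "distr M borel Y"
    by (rule prob_space_distr) simp
  interpret XY: pair_prob_space "distr M borel X" "distr M borel Y" ..
  have "AE t in distr M borel X. AE s in distr M borel Y. t \<noteq> s"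
    using no_atoms by (intro AE_I2 AE_I'[where N = "{_}"]) auto
  moreover have "{p \<in> space (distr M borel X \<Otimes>\<^sub>M distr M borel Y). fst p \<noteq> snd p}
      \<in> sets (distr M borel X \<Otimes>\<^sub>M distr M borel Y)"
    by measurable
  ultimately have "AE p in distr M borel X \<Otimes>\<^sub>M distr M borel Y. fst p \<noteq> snd p"
    by (intro XY.AE_pair_measure) simp_all
  then show ?thesis
    unfolding pair by (subst (asm) AE_distr_iff) auto
qed

text \<open>The law of the vector is a power of \<open>D\<close>, hence invariant under reindexing;
  ties are excluded pair by pair.\<close>

lemma (in prob_space) exchangeable_without_ties_iid:
  fixes X :: "nat \<Rightarrow> 'a \<Rightarrow> real"
  assumes indep: "indep_vars (\<lambda>_. borel) X {1..n}"
    and law: "\<And>i. i \<in> {1..n} \<Longrightarrow> distr M borel (X i) = D"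
    and no_atoms: "\<And>t. emeasure D {t} = 0"
  shows "exchangeable_without_ties n (distr M (sample_space n) (\<lambda>\<omega>. \<lambda>i\<in>{1..n}. X i \<omega>))"
    (is "exchangeable_without_ties n ?P")
proof
  have rv [measurable]: "X i \<in> borel_measurable M" if "i \<in> {1..n}" for i
    using indep that by (auto simp: indep_vars_def)
  show "sets ?P = sets (sample_space n)"
    by simp
  show "distr ?P ?P (\<lambda>x. \<lambda>i\<in>{1..n}. x (\<sigma> i)) = ?P" if \<sigma>: "\<sigma> permutes {1..n}" for \<sigma>
  \<comment> \<open>For \<open>n = 0\<close> no variable forces \<open>D\<close> to be a probability
    measure, but the space has a single point, which relabelling fixes.\<close>
  proof (cases "n = 0")
    case True
    have "distr ?P ?P (\<lambda>x. \<lambda>i\<in>{1..n}. x (\<sigma> i)) = distr ?P ?P (\<lambda>x. x)"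
      by (rule distr_cong) (auto simp: True space_PiM)
    then show ?thesis
      by (simp add: distr_id2)
  next
    case False
    then have "1 \<in> {1..n}"
      by auto
    then interpret D: prob_space D
      using law[of 1] prob_space_distr[OF rv] by metis
    have "?P = PiM {1..n} (\<lambda>i. distr M borel (X i))"
      using indep_vars_iff_distr_eq_PiM'[where I = "{1..n}" and M' = "\<lambda>_. borel" and X = X] indep False rv by simp
    also have "\<dots> = PiM {1..n} (\<lambda>_. D)"
      by (intro PiM_cong) (auto simp: law)
    finally have P: "?P = PiM {1..n} (\<lambda>_. D)" .
    show ?thesis
      unfolding P using permutes_in_image[OF \<sigma>]
      by (intro distr_PiM_reindex) (auto simp: D.prob_space_axioms permutes_inj_on[OF \<sigma>])
  qed
  have M_neq: "AE \<omega> in M. X i \<omega> \<noteq> X j \<omega>" if ij: "i \<in> {1..n}" "j \<in> {1..n}" "i \<noteq> j" for i j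
  proof (rule AE_indep_var_neq)
    \<comment> \<open>The subfamilies over the disjoint index sets \<open>{i}\<close> and
      \<open>{j}\<close> are independent; evaluating their only coordinates gives the pair.\<close>
    have "indep_var borel ((\<lambda>x. x i) \<circ> (\<lambda>\<omega>. \<lambda>k\<in>{i}. X k \<omega>)) borel ((\<lambda>x. x j) \<circ> (\<lambda>\<omega>. \<lambda>k\<in>{j}. X k \<omega>))"
      using ij by (intro indep_var_compose[OF indep_var_restrict[OF indep]] measurable_component_singleton) auto
    then show "indep_var borel (X i) borel (X j)"
      by (simp add: comp_def)
    show "emeasure (distr M borel (X j)) {t} = 0" for t
      using law ij no_atoms by simp
  qed
  have "AE x in ?P. x i \<noteq> x j" if ij: "i \<in> {1..n}" "j \<in> {1..n}" "i \<noteq> j" for i j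
  proof (subst AE_distr_iff)
    show "(\<lambda>\<omega>. \<lambda>i\<in>{1..n}. X i \<omega>) \<in> M \<rightarrow>\<^sub>M sample_space n"
      by (intro measurable_restrict rv)
    show "{x \<in> space (sample_space n). x i \<noteq> x j} \<in> sets (sample_space n)"
      by (intro borel_measurable_neq measurable_component_singleton ij)
    show "AE \<omega> in M. (\<lambda>i\<in>{1..n}. X i \<omega>) i \<noteq> (\<lambda>i\<in>{1..n}. X i \<omega>) j"
      using M_neq[OF ij] ij by simp
  qed
  then have "AE x in ?P. \<forall>i\<in>{1..n}. \<forall>j\<in>{1..n}. i \<noteq> j \<longrightarrow> x i \<noteq> x j"
    by (auto simp: AE_ball_countable)
  then show "AE x in ?P. inj_on x {1..n}"
    by eventually_elim (auto simp: inj_on_def)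
qed

section \<open>Differences of extended nonnegative numbers\<close>

text \<open>The hypothesis keeps one kind of part finite throughout, so no infinities of opposite
  sign meet.\<close>

lemma enn2ereal_diff_add:
  fixes a b c d :: ennreal
  assumes "a + c < \<infinity> \<or> b + d < \<infinity>"
  shows "enn2ereal a - enn2ereal b + (enn2ereal c - enn2ereal d) = enn2ereal (a + c) - enn2ereal (b + d)"
  using assms
  by (cases a; cases b; cases c; cases d)
    (auto simp: plus_ennreal.rep_eq top_ennreal.rep_eq)

lemma sum_enn2ereal_diff:
  fixes p q :: "'b \<Rightarrow> ennreal"
  assumes "finite A" and "sum p A < \<infinity> \<or> sum q A < \<infinity>"
  shows "(\<Sum>a\<in>A. enn2ereal (p a) - enn2ereal (q a)) = enn2ereal (sum p A) - enn2ereal (sum q A)"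
  using assms
proof (induction A rule: finite_induct)
  case empty
  then show ?case
    by (simp add: zero_ennreal.rep_eq)
next
  case (insert a A)
  then have fin: "p a + sum p A < \<infinity> \<or> q a + sum q A < \<infinity>"
    by simp
  then have "sum p A < \<infinity> \<or> sum q A < \<infinity>"
    by (auto simp: less_top[symmetric])
  with insert enn2ereal_diff_add[OF fin] show ?case
    by simp
qed

text \<open>A positive real factor preserves both finiteness and infinity, so it can be cancelled
  even when both parts are infinite. It serves to move \<open>fact n\<close> to the other
  side.\<close>

lemma enn2ereal_diff_cmult:
  fixes a b :: ennreal
  assumes "0 < c"
  shows "enn2ereal a - enn2ereal b
    = ereal (1 / c) * (enn2ereal (ennreal c * a) - enn2ereal (ennreal c * b))"
  using assms
  by (cases a; cases b)
    (auto simp: top_ennreal.rep_eq ennreal_mult_top times_ennreal.rep_eq field_simps)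

lemma enn2ereal_diff_eq_PInf_MInf:
  fixes a b :: ennreal
  assumes "a < \<infinity> \<or> b < \<infinity>"
  shows "enn2ereal a - enn2ereal b = \<infinity> \<longleftrightarrow> a = \<infinity>" "enn2ereal a - enn2ereal b = - \<infinity> \<longleftrightarrow> b = \<infinity>"
  using assms by (cases a; cases b; auto simp: top_ennreal.rep_eq)+

section \<open>The identities for the sample\<close>

theorem proposition2:
  fixes M :: "'a measure" and X :: "nat \<Rightarrow> 'a \<Rightarrow> real" and n :: nat
    and F f h :: "real \<Rightarrow> real" and \<nu> :: "nat set \<Rightarrow> real"
    and Y :: "'a \<Rightarrow> real" and Y' :: "(nat \<Rightarrow> nat) \<Rightarrow> 'a \<Rightarrow> real"
  assumes "prob_space M"
    and "prob_space.indep_vars M (\<lambda>_. borel) X {1..n}"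
    and "\<And>i. i \<in> {1..n} \<Longrightarrow> cdf (distr M borel (X i)) = F"
    and "continuous_on UNIV F"
    and "f \<in> borel_measurable borel" and "\<And>t. 0 \<le> f t"
    and "\<And>i. i \<in> {1..n} \<Longrightarrow> distributed M lborel (X i) (\<lambda>t. ennreal (f t))"
    and "h \<in> borel_measurable borel"
    and "game n \<nu>"
    and Y_def: "Y = (\<lambda>\<omega>. choquet n \<nu> (\<lambda>j. X j \<omega>))"
    and Y'_def: "Y' = (\<lambda>\<sigma> \<omega>. order_stat_comb n \<nu> \<sigma> (\<lambda>j. X j \<omega>))"
  shows "(integrable M (\<lambda>\<omega>. h (Y \<omega>)) \<longleftrightarrow>
            (\<forall>\<sigma>. \<sigma> permutes {1..n} \<longrightarrow> integrable M (\<lambda>\<omega>. h (Y' \<sigma> \<omega>))))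
       \<and> (integrable M (\<lambda>\<omega>. h (Y \<omega>)) \<longrightarrow>
            (\<integral>\<omega>. h (Y \<omega>) \<partial>M) = 1 / fact n * (\<Sum>\<sigma> | \<sigma> permutes {1..n}. \<integral>\<omega>. h (Y' \<sigma> \<omega>) \<partial>M))
       \<and> (has_ext_expectation M (\<lambda>\<omega>. h (Y \<omega>)) \<longleftrightarrow>
            has_ext_expectation_sum M (\<lambda>\<sigma> \<omega>. h (Y' \<sigma> \<omega>)) {\<sigma>. \<sigma> permutes {1..n}})
       \<and> (has_ext_expectation M (\<lambda>\<omega>. h (Y \<omega>)) \<longrightarrow>
            ext_expectation M (\<lambda>\<omega>. h (Y \<omega>)) =
              ereal (1 / fact n) *
                (\<Sum>\<sigma> | \<sigma> permutes {1..n}. ext_expectation M (\<lambda>\<omega>. h (Y' \<sigma> \<omega>))))"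
proof -
  interpret prob_space M by fact
  let ?S = "{\<sigma>. \<sigma> permutes {1..n}}"
  let ?X = "\<lambda>\<omega>. \<lambda>i\<in>{1..n}. X i \<omega>"
  note [measurable] = assms(8)
  have [measurable]: "X i \<in> borel_measurable M" if "i \<in> {1..n}" for i
    using assms(2) that by (auto simp: indep_vars_def)
  have X_meas [measurable]: "?X \<in> M \<rightarrow>\<^sub>M sample_space n"
    by (rule measurable_restrict) simp
  have [measurable]: "f \<in> borel_measurable borel"
    by fact
  interpret exchangeable_without_ties n "distr M (sample_space n) ?X"
  proof (rule exchangeable_without_ties_iid[OF assms(2)])
    show "distr M borel (X i) = density lborel (\<lambda>t. ennreal (f t))" if "i \<in> {1..n}" for i
      using assms(7)[OF that] by (auto simp: distributed_def cong: distr_cong)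
    \<comment> \<open>Single points are Lebesgue null, so a law with a density has no atoms.\<close>
    show "emeasure (density lborel (\<lambda>t. ennreal (f t))) {t} = 0" for t
      by (subst emeasure_density) auto
  qed
  \<comment> \<open>Only the coordinates in \<open>{1..n}\<close> enter, so the sample may be
    replaced by a point of \<open>sample_space n\<close>.\<close>
  have Y: "Y = (\<lambda>\<omega>. choquet n \<nu> (?X \<omega>))"
    unfolding Y_def by (intro ext choquet_cong) simp
  have Y': "Y' = (\<lambda>\<sigma> \<omega>. order_stat_comb n \<nu> \<sigma> (?X \<omega>))"
    unfolding Y'_def by (intro ext order_stat_comb_cong) simp
  have meas: "(\<lambda>\<omega>. h (Y \<omega>)) \<in> borel_measurable M" "(\<lambda>\<omega>. h (Y' \<sigma> \<omega>)) \<in> borel_measurable M" for \<sigma>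
    unfolding Y Y' by measurable
  have transfer: "fact n * (\<integral>\<^sup>+\<omega>. g (Y \<omega>) \<partial>M) = (\<Sum>\<sigma>\<in>?S. \<integral>\<^sup>+\<omega>. g (Y' \<sigma> \<omega>) \<partial>M)"
    if [measurable]: "g \<in> borel_measurable borel" for g :: "real \<Rightarrow> ennreal"
  proof -
    have "(\<integral>\<^sup>+x. g (u x) \<partial>distr M (sample_space n) ?X) = (\<integral>\<^sup>+\<omega>. g (u (?X \<omega>)) \<partial>M)"
      if [measurable]: "u \<in> borel_measurable (sample_space n)" for u
      by (rule nn_integral_distr) measurable
    with nn_integral_choquet[OF that, of \<nu>] show ?thesis
      by (simp only: Y Y' measurable_choquet measurable_order_stat_comb)
  qed

  \<comment> \<open>From here on the claims are arithmetic of positive parts \<open>a\<close>,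
    \<open>p\<close> and negative parts \<open>b\<close>, \<open>q\<close>, linked by
    \<open>transfer\<close>.\<close>
  define a where "a = pos_integral M (\<lambda>\<omega>. h (Y \<omega>))"
  define b where "b = neg_integral M (\<lambda>\<omega>. h (Y \<omega>))"
  define p where "p \<sigma> = pos_integral M (\<lambda>\<omega>. h (Y' \<sigma> \<omega>))" for \<sigma>
  define q where "q \<sigma> = neg_integral M (\<lambda>\<omega>. h (Y' \<sigma> \<omega>))" for \<sigma>
  have fact: "(fact n :: ennreal) = ennreal (fact n)"
    by (metis ennreal_of_nat_eq_real_of_nat of_nat_fact)
  have p_sum: "ennreal (fact n) * a = sum p ?S"
    using transfer[of "\<lambda>t. ennreal (h t)"] by (simp add: a_def p_def pos_integral_def fact)
  have q_sum: "ennreal (fact n) * b = sum q ?S"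
    using transfer[of "\<lambda>t. ennreal (- h t)"] by (simp add: b_def q_def neg_integral_def fact)
  have a_fin: "a < \<infinity> \<longleftrightarrow> sum p ?S < \<infinity>" and b_fin: "b < \<infinity> \<longleftrightarrow> sum q ?S < \<infinity>"
    unfolding p_sum[symmetric] q_sum[symmetric]
    by (auto simp: ennreal_mult_less_top)
  have p_fin: "sum p ?S < \<infinity> \<longleftrightarrow> (\<forall>\<sigma>\<in>?S. p \<sigma> < \<infinity>)"
    and q_fin: "sum q ?S < \<infinity> \<longleftrightarrow> (\<forall>\<sigma>\<in>?S. q \<sigma> < \<infinity>)"
    by (auto simp: less_top[symmetric] finite_permutations)
  have exp_Y: "ext_expectation M (\<lambda>\<omega>. h (Y \<omega>)) = enn2ereal a - enn2ereal b"
    and exp_Y': "ext_expectation M (\<lambda>\<omega>. h (Y' \<sigma> \<omega>)) = enn2ereal (p \<sigma>) - enn2ereal (q \<sigma>)" for \<sigma>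
    by (simp_all add: ext_expectation_def a_def b_def p_def q_def)
  have has_Y: "has_ext_expectation M (\<lambda>\<omega>. h (Y \<omega>)) \<longleftrightarrow> a < \<infinity> \<or> b < \<infinity>"
    and has_Y': "has_ext_expectation M (\<lambda>\<omega>. h (Y' \<sigma> \<omega>)) \<longleftrightarrow> p \<sigma> < \<infinity> \<or> q \<sigma> < \<infinity>" for \<sigma>
    by (simp_all add: has_ext_expectation_def a_def b_def p_def q_def meas)
  have int_Y: "integrable M (\<lambda>\<omega>. h (Y \<omega>)) \<longleftrightarrow> a < \<infinity> \<and> b < \<infinity>"
    and int_Y': "integrable M (\<lambda>\<omega>. h (Y' \<sigma> \<omega>)) \<longleftrightarrow> p \<sigma> < \<infinity> \<and> q \<sigma> < \<infinity>" for \<sigma>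
    by (simp_all add: real_integrable_def a_def b_def p_def q_def pos_integral_def
        neg_integral_def meas less_top)

  have integrable_iff: "integrable M (\<lambda>\<omega>. h (Y \<omega>)) \<longleftrightarrow>
      (\<forall>\<sigma>. \<sigma> permutes {1..n} \<longrightarrow> integrable M (\<lambda>\<omega>. h (Y' \<sigma> \<omega>)))"
    unfolding int_Y int_Y' a_fin b_fin p_fin q_fin by blast
  \<comment> \<open>Existence of each term supplies the finite part under which an infinite
    expectation reveals which part is infinite.\<close>
  have "has_ext_expectation_sum M (\<lambda>\<sigma> \<omega>. h (Y' \<sigma> \<omega>)) ?S \<longleftrightarrow>
      (\<forall>\<sigma>\<in>?S. p \<sigma> < \<infinity> \<or> q \<sigma> < \<infinity>) \<and> \<not> ((\<exists>\<sigma>\<in>?S. p \<sigma> = \<infinity>) \<and> (\<exists>\<sigma>\<in>?S. q \<sigma> = \<infinity>))"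
    unfolding has_ext_expectation_sum_def has_Y' exp_Y' using enn2ereal_diff_eq_PInf_MInf by blast
  \<comment> \<open>The condition says that all \<open>p \<sigma>\<close> or all
    \<open>q \<sigma>\<close> are finite, that is, that one of the two finite sums is.\<close>
  also have "\<dots> \<longleftrightarrow> a < \<infinity> \<or> b < \<infinity>"
    unfolding a_fin b_fin p_fin q_fin by (auto simp: less_top)
  finally have has_iff: "has_ext_expectation M (\<lambda>\<omega>. h (Y \<omega>)) \<longleftrightarrow>
      has_ext_expectation_sum M (\<lambda>\<sigma> \<omega>. h (Y' \<sigma> \<omega>)) ?S"
    by (simp add: has_Y)
  have ext_eq: "ext_expectation M (\<lambda>\<omega>. h (Y \<omega>)) =
      ereal (1 / fact n) * (\<Sum>\<sigma>\<in>?S. ext_expectation M (\<lambda>\<omega>. h (Y' \<sigma> \<omega>)))"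
    if "has_ext_expectation M (\<lambda>\<omega>. h (Y \<omega>))"
  proof -
    have "sum p ?S < \<infinity> \<or> sum q ?S < \<infinity>"
      using that by (simp only: has_Y a_fin b_fin)
    then have sum_eq: "(\<Sum>\<sigma>\<in>?S. ext_expectation M (\<lambda>\<omega>. h (Y' \<sigma> \<omega>))) = enn2ereal (sum p ?S) - enn2ereal (sum q ?S)"
      unfolding exp_Y' by (rule sum_enn2ereal_diff[OF finite_permutations[OF finite_atLeastAtMost]])
    show ?thesis
      unfolding sum_eq exp_Y p_sum[symmetric] q_sum[symmetric]
      by (rule enn2ereal_diff_cmult) simp
  qed
  have int_eq: "(\<integral>\<omega>. h (Y \<omega>) \<partial>M) = 1 / fact n * (\<Sum>\<sigma>\<in>?S. \<integral>\<omega>. h (Y' \<sigma> \<omega>) \<partial>M)"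
    if int: "integrable M (\<lambda>\<omega>. h (Y \<omega>))"
  proof -
    \<comment> \<open>Under integrability all expectations involved are real, so the identity of
      integrals can be read off from \<open>ext_eq\<close>.\<close>
    have "(\<Sum>\<sigma>\<in>?S. ext_expectation M (\<lambda>\<omega>. h (Y' \<sigma> \<omega>))) = (\<Sum>\<sigma>\<in>?S. ereal (\<integral>\<omega>. h (Y' \<sigma> \<omega>) \<partial>M))"
      using int integrable_iff by (intro sum.cong) (auto simp: ext_expectation_integrable(2))
    with ext_eq[OF ext_expectation_integrable(1)[OF int]] show ?thesis
      unfolding ext_expectation_integrable(2)[OF int] by simp
  qed
  show ?thesis
    by (intro conjI impI integrable_iff int_eq has_iff ext_eq)
qed

end
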